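(* Let $j\ge0$ and $b\ge1$ be fixed integers, let $c\ge0$ be fixed, and let $a=cm+b$. For $\pi=(\pi_1,\dots,\pi_m)$ chosen uniformly at random from $\mathrm{PF}(a,b,m)$, as $m\to\infty$, $$\mathbb P(\pi_1=a+(m-1)b-j)\sim\frac{1-\mathbb Q_{b/(b+c)}(\lfloor j/b\rfloor+2)}{(b+c)m}.$$
   Context: $\mathrm{PF}(a,b,m)$, for positive integers $a,b,m$, is the set of $(a,b)$-parking functions of length $m$: sequences $(\pi_1,\dots,\pi_m)$ of positive integers whose non-decreasing rearrangement $(\lambda_1,\dots,\lambda_m)$ satisfies $\lambda_i\le a+(i-1)b$ for all $1\le i\le m$. Since $a=cm+b$ must be a positive integer, $m\to\infty$ runs through values for which $cm$ is an integer. A random variable $X$ has the Borel distribution with parameter $\mu$ ($0\le\mu\le1$) if $\mathbb P_\mu(X=n)=\frac{e^{-\mu n}(\mu n)^{n-1}}{n!}$ for $n=1,2,\dots$. Its tail function is $\mathbb Q_\mu(n)=\mathbb P_\mu(X\ge n)$. $\lfloor x\rfloor$ is the largest integer $\le x$. $f(m)\sim g(m)$ means $f(m)/g(m)\to1$ as $m\to\infty$. *)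

theory Defs
  imports "HOL-Probability.Probability" "HOL-Library.Landau_Symbols"
begin

text \<open>Positions are 0-based here: entry \<open>i\<close> of \<open>sort \<pi>\<close> is \<open>\<lambda>\<^sub>i\<^sub>+\<^sub>1\<close>.\<close>

definition parking_functions :: "nat \<Rightarrow> nat \<Rightarrow> nat \<Rightarrow> nat list set" where
  "parking_functions a b m =
     {\<pi>. length \<pi> = m \<and> (\<forall>x\<in>set \<pi>. 1 \<le> x) \<and> (\<forall>i<m. sort \<pi> ! i \<le> a + i * b)}"

text \<open>
  \<open>pmf_of_set\<close> is meaningful only for finite nonempty sets, which the next two facts
  guarantee.
\<close>

lemma finite_parking_functions: "finite (parking_functions a b m)"
proof (rule finite_subset)
  show "parking_functions a b m \<subseteq> {\<pi>. set \<pi> \<subseteq> {..a + m * b} \<and> length \<pi> = m}"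
  proof clarify
    fix \<pi> assume \<pi>: "\<pi> \<in> parking_functions a b m"
    show "set \<pi> \<subseteq> {..a + m * b} \<and> length \<pi> = m"
    proof (intro conjI subsetI)
      fix x assume "x \<in> set \<pi>"
      then have "x \<in> set (sort \<pi>)" by simp
      then obtain i where i: "i < length (sort \<pi>)" "sort \<pi> ! i = x"
        by (metis in_set_conv_nth)
      then have "x \<le> a + i * b" "i \<le> m"
        using \<pi> by (auto simp: parking_functions_def)
      moreover have "i * b \<le> m * b" using \<open>i \<le> m\<close> by simp
      ultimately show "x \<in> {..a + m * b}" by (simp only: atMost_iff)
    qed (use \<pi> in \<open>simp add: parking_functions_def\<close>)
  qed
  show "finite {\<pi>. set \<pi> \<subseteq> {..a + m * b} \<and> length \<pi> = m}"
    by (intro finite_lists_length_eq) simp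
qed

lemma parking_functions_nonempty: "1 \<le> a \<Longrightarrow> parking_functions a b m \<noteq> {}"
proof -
  assume "1 \<le> a"
  moreover have "sort (replicate m 1) = replicate m (1::nat)"
    by (rule sorted_sort_id) simp
  ultimately have "replicate m 1 \<in> parking_functions a b m"
    by (auto simp: parking_functions_def)
  then show ?thesis by blast
qed

definition borel_mass :: "real \<Rightarrow> nat \<Rightarrow> real" where
  "borel_mass \<mu> n =
     (if n = 0 then 0 else exp (- \<mu> * real n) * (\<mu> * real n) ^ (n - 1) / fact n)"

text \<open>
  The Borel distribution with parameter \<open>\<mu>\<close>, as a measure on the natural numbers; it is
  a probability measure for \<open>0 \<le> \<mu> \<le> 1\<close>. It is unrelated to the Borel sigma algebra
  \<open>borel\<close>.
\<close>

definition borel_distribution :: "real \<Rightarrow> nat measure" where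
  "borel_distribution \<mu> = density (count_space UNIV) (\<lambda>n. ennreal (borel_mass \<mu> n))"

definition borel_tail :: "real \<Rightarrow> nat \<Rightarrow> real" where
  "borel_tail \<mu> n = measure (borel_distribution \<mu>) {n..}"

end

theory Submission
  imports Defs "HOL-Complex_Analysis.Complex_Analysis" "HOL-Real_Asymp.Real_Asymp"
begin

text \<open>
  A word of positive integers is parking if, for every \<open>t\<close> below its length, more than \<open>t\<close> of
  its entries are at most \<open>a + t * b\<close>. Cut an arbitrary word at the first \<open>s\<close> where this fails: exactly \<open>s\<close>
  entries are at most \<open>a + s * b\<close>, they form a parking function of length \<open>s\<close>, and the
  remaining entries are all larger (\<open>card_by_first_failure\<close>). This one decomposition is used
  twice.

  For all words over \<open>{1..a + m * b}\<close> it gives a recursion for the number of parking functions,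
  which Abel's binomial identity solves: there are \<open>a * (a + m * b) ^ (m - 1)\<close> of them
  (\<open>card_parking_functions\<close>). For the entries that follow a first entry
  \<open>a + (m - 1) * b - j\<close>, the first failure can only happen at \<open>s = m - 1 - i\<close> with
  \<open>i \<le> j div b\<close>, and then the \<open>i\<close> large entries, lowered by \<open>a + s * b\<close>, form a
  \<open>(b, b)\<close>-parking function (\<open>parking_with_first_entry\<close>). Hence the probability is a sum of
  \<open>j div b + 1\<close> explicit terms, and the number of terms is independent of \<open>m\<close>.

  Multiplied by \<open>m\<close>, the term with index \<open>i\<close> tends to the Borel mass at \<open>i + 1\<close> for the
  parameter \<open>\<mu> = b / (b + c)\<close>, divided by \<open>b + c\<close> (\<open>first_entry_term_limit\<close>). The limit is a
  partial sum of Borel masses; to express it by the tail function one needs that the Borel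
  masses have total \<open>1\<close> for \<open>0 < \<mu> \<le> 1\<close> (\<open>borel_mass_sums\<close>). For \<open>\<mu> < 1\<close> this is the
  statement that the tree function, the power series with coefficients \<open>n ^ (n - 1) / n!\<close>,
  inverts \<open>z * exp (- z)\<close>. It holds for formal power series, because the coefficients of the
  composition are finite differences of polynomials of too small degree, and extends to
  the interval by analytic continuation. The case \<open>\<mu> = 1\<close>, that is \<open>c = 0\<close>, follows by
  monotone approximation.
\<close>

section \<open>Decomposition of words at the first failure\<close>

abbreviation count_le :: "nat \<Rightarrow> nat list \<Rightarrow> nat" where
  "count_le v xs \<equiv> length (filter (\<lambda>x. x \<le> v) xs)"

lemma sorted_nth_le_iff:
  "sorted xs \<Longrightarrow> i < length xs \<Longrightarrow> xs ! i \<le> v \<longleftrightarrow> i < length (filter (\<lambda>x. x \<le> v) xs)"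
proof (induction xs arbitrary: i)
  case (Cons x xs)
  show ?case
  proof (cases "x \<le> v")
    case True
    then show ?thesis using Cons by (cases i) auto
  next
    case False
    then have "filter (\<lambda>x. x \<le> v) (x # xs) = []"
      using Cons.prems(1) by (auto simp: filter_empty_conv)
    moreover have "x \<le> (x # xs) ! i"
      using Cons.prems by (cases i) auto
    ultimately show ?thesis using False by (metis leD length_0_conv not_less_zero order.trans)
  qed
qed simp

text \<open>
  The rearrangement disappears: the parking condition bounds from below the number of
  entries under each threshold \<open>a + t * b\<close>. In this form the condition can be tested on
  the small and on the large entries of a word separately.
\<close>

lemma parking_functions_alt:
  "parking_functions a b m =
     {\<pi>. length \<pi> = m \<and> (\<forall>x\<in>set \<pi>. 1 \<le> x) \<and> (\<forall>t<m. t < count_le (a + t * b) \<pi>)}"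
proof -
  have "sort \<pi> ! t \<le> v \<longleftrightarrow> t < count_le v \<pi>" if "t < length \<pi>" for \<pi> t v
    using sorted_nth_le_iff[of "sort \<pi>" t v] that by (simp add: filter_sort)
  then show ?thesis unfolding parking_functions_def by auto
qed

text \<open>
  A word is determined by its small entries, its large entries, each in their order, and the
  positions of the small ones; the words with given parts are the shuffles of these parts,
  which is where the binomial coefficient comes from.
\<close>

lemma card_filter_split:
  assumes "finite A" "finite B"
    and A: "\<And>xs. xs \<in> A \<Longrightarrow> length xs = s \<and> (\<forall>x\<in>set xs. P x)"
    and B: "\<And>ys. ys \<in> B \<Longrightarrow> length ys = t \<and> (\<forall>y\<in>set ys. \<not> P y)"
  shows "card {zs. filter P zs \<in> A \<and> filter (\<lambda>x. \<not> P x) zs \<in> B} = (s + t choose s) * card A * card B"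
    and "finite {zs. filter P zs \<in> A \<and> filter (\<lambda>x. \<not> P x) zs \<in> B}"
proof -
  have sh: "{zs. filter P zs = xs \<and> filter (\<lambda>x. \<not> P x) zs = ys} = shuffles xs ys"
    if "xs \<in> A" "ys \<in> B" for xs ys
    using inv_image_partition[of xs P ys] A[OF that(1)] B[OF that(2)]
    by (auto simp: vimage_def o_def)
  have eq: "{zs. filter P zs \<in> A \<and> filter (\<lambda>x. \<not> P x) zs \<in> B} = (\<Union>(xs,ys)\<in>A \<times> B. shuffles xs ys)"
  proof -
    have "{zs. filter P zs \<in> A \<and> filter (\<lambda>x. \<not> P x) zs \<in> B} =
        (\<Union>(xs,ys)\<in>A \<times> B. {zs. filter P zs = xs \<and> filter (\<lambda>x. \<not> P x) zs = ys})" by auto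
    also have "\<dots> = (\<Union>(xs,ys)\<in>A \<times> B. shuffles xs ys)"
    proof (intro SUP_cong refl)
      fix p assume "p \<in> A \<times> B"
      then show "(case p of (xs, ys) \<Rightarrow> {zs. filter P zs = xs \<and> filter (\<lambda>x. \<not> P x) zs = ys}) =
          (case p of (xs, ys) \<Rightarrow> shuffles xs ys)"
        using sh[of "fst p" "snd p"] by (simp add: case_prod_beta mem_Times_iff)
    qed
    finally show ?thesis .
  qed
  show "finite {zs. filter P zs \<in> A \<and> filter (\<lambda>x. \<not> P x) zs \<in> B}"
    unfolding eq using assms(1,2) by auto
  have disj: "\<forall>p\<in>A \<times> B. \<forall>q\<in>A \<times> B. p \<noteq> q \<longrightarrow>
      (case p of (xs, ys) \<Rightarrow> shuffles xs ys) \<inter> (case q of (xs, ys) \<Rightarrow> shuffles xs ys) = {}"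
  proof (intro ballI impI, rule ccontr)
    fix p q
    assume *: "p \<in> A \<times> B" "q \<in> A \<times> B" "p \<noteq> q"
      "(case p of (xs, ys) \<Rightarrow> shuffles xs ys) \<inter> (case q of (xs, ys) \<Rightarrow> shuffles xs ys) \<noteq> {}"
    then obtain zs where zs: "zs \<in> shuffles (fst p) (snd p)" "zs \<in> shuffles (fst q) (snd q)"
      by (auto simp: case_prod_beta)
    have p: "fst p \<in> A" "snd p \<in> B" and q: "fst q \<in> A" "snd q \<in> B" using * by auto
    have "fst p = fst q" "snd p = snd q"
      using zs unfolding sh[OF p, symmetric] sh[OF q, symmetric] by simp_all
    then show False using *(3) by (simp add: prod_eq_iff)
  qed
  have "card (\<Union>(xs,ys)\<in>A \<times> B. shuffles xs ys) = (\<Sum>(xs,ys)\<in>A \<times> B. card (shuffles xs ys))"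
    by (subst card_UN_disjoint[OF _ _ disj]) (use assms(1,2) in \<open>auto simp: case_prod_beta\<close>)
  also have "\<dots> = (\<Sum>(xs,ys)\<in>A \<times> B. (s + t choose s))"
  proof (intro sum.cong refl, clarify)
    fix xs ys assume *: "xs \<in> A" "ys \<in> B"
    then have "set xs \<inter> set ys = {}" using A B by blast
    then show "card (shuffles xs ys) = (s + t choose s)"
      using card_disjoint_shuffles[of xs ys] A[OF *(1)] B[OF *(2)] by simp
  qed
  finally show "card {zs. filter P zs \<in> A \<and> filter (\<lambda>x. \<not> P x) zs \<in> B} = (s + t choose s) * card A * card B"
    unfolding eq by (simp add: case_prod_beta card_cartesian_product)
qed

text \<open>
  The parking condition asks for more than \<open>t\<close> entries under the threshold \<open>a + t * b\<close>,
  for every \<open>t\<close> below the length. The predicate says that \<open>s\<close>, among all natural numbers, is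
  the first where this fails. The equation \<open>count = s\<close> in place of \<open>count \<le> s\<close> is no
  restriction: if there are more than \<open>s - 1\<close> entries under the preceding threshold, there
  are at least \<open>s\<close> under this one.
\<close>

definition first_failure :: "nat \<Rightarrow> nat \<Rightarrow> nat \<Rightarrow> nat list \<Rightarrow> bool" where
  "first_failure a b s xs \<longleftrightarrow>
     count_le (a + s * b) xs = s \<and> (\<forall>t<s. t < count_le (a + t * b) xs)"

lemma count_le_mono: "u \<le> v \<Longrightarrow> count_le u xs \<le> count_le v xs"
  by (induction xs) auto

text \<open>
  A word of length \<open>m\<close> cannot have more than \<open>m\<close> small entries, so a failure occurs at
  \<open>m\<close> at the latest; for a word of positive integers, the first one occurs at \<open>m\<close> exactly
  when the word is parking.
\<close>

lemma first_failure_exists: "\<exists>s\<le>length xs. first_failure a b s xs"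
proof -
  define s where "s = (LEAST s. count_le (a + s * b) xs \<le> s)"
  have ex: "count_le (a + length xs * b) xs \<le> length xs" by simp
  have le: "count_le (a + s * b) xs \<le> s" unfolding s_def by (rule LeastI[of _ "length xs"]) simp
  have lt: "t < count_le (a + t * b) xs" if "t < s" for t
    using not_less_Least[of t "\<lambda>s. count_le (a + s * b) xs \<le> s"] that unfolding s_def by auto
  have "s \<le> count_le (a + s * b) xs"
  proof (cases s)
    case (Suc t)
    have "count_le (a + t * b) xs \<le> count_le (a + s * b) xs"
      by (rule count_le_mono) (simp add: Suc)
    then show ?thesis using lt[of t] Suc by simp
  qed simp
  moreover have "s \<le> length xs" unfolding s_def by (rule Least_le) simp
  ultimately show ?thesis using le lt unfolding first_failure_def by auto
qed

lemma first_failure_unique: "first_failure a b s xs \<Longrightarrow> first_failure a b s' xs \<Longrightarrow> s = s'"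
  unfolding first_failure_def by (metis less_irrefl nat_neq_iff)

text \<open>
  The entries under the first failing threshold form a parking function of length \<open>s\<close>,
  because removing larger entries does not change the counts at the lower thresholds.
\<close>

lemma filter_parking_iff:
  assumes "\<forall>x\<in>set xs. 1 \<le> x"
  shows "filter (\<lambda>x. x \<le> a + s * b) xs \<in> parking_functions a b s \<longleftrightarrow> first_failure a b s xs"
proof -
  have "count_le (a + t * b) (filter (\<lambda>x. x \<le> a + s * b) xs) = count_le (a + t * b) xs"
    if "t < s" for t
  proof -
    have "t * b \<le> s * b" using that by simp
    then have "x \<le> a + t * b \<Longrightarrow> x \<le> a + s * b" for x by linarith
    then have "(\<lambda>x. x \<le> a + s * b \<and> x \<le> a + t * b) = (\<lambda>x. x \<le> a + t * b)" by blast
    then show ?thesis by (simp add: conj_commute)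
  qed
  then show ?thesis using assms unfolding parking_functions_alt first_failure_def by auto
qed

lemma all_iff_filters:
  "(\<forall>x\<in>set xs. Q x) \<longleftrightarrow>
     (\<forall>x\<in>set (filter P xs). Q x) \<and> (\<forall>x\<in>set (filter (\<lambda>x. \<not> P x) xs). Q x)"
  by auto

text \<open>
  The common counting principle behind the two decompositions below. They differ only in what
  is demanded of the entries above the first failing threshold: that they are bounded (for
  the words over an alphabet) or that, shifted down, they again form a parking function (for
  the words that become parking after one more entry is added). Different \<open>s\<close> give disjoint
  classes since the first failure is unique.
\<close>

lemma card_by_first_failure:
  fixes a b n :: nat and B :: "nat \<Rightarrow> nat list set"
  assumes "R \<subseteq> {..n}"
    and fin: "\<And>s. s \<in> R \<Longrightarrow> finite (B s)"
    and B: "\<And>s ys. s \<in> R \<Longrightarrow> ys \<in> B s \<Longrightarrow> length ys = n - s \<and> (\<forall>y\<in>set ys. a + s * b < y)"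
  shows "card {zs. \<exists>s\<in>R. filter (\<lambda>x. x \<le> a + s * b) zs \<in> parking_functions a b s \<and>
                          filter (\<lambda>x. \<not> x \<le> a + s * b) zs \<in> B s} =
         (\<Sum>s\<in>R. (n choose s) * card (parking_functions a b s) * card (B s))"
proof -
  define Z where "Z s = {zs. filter (\<lambda>x. x \<le> a + s * b) zs \<in> parking_functions a b s \<and>
                          filter (\<lambda>x. \<not> x \<le> a + s * b) zs \<in> B s}" for s
  have sub: "\<forall>x\<in>set \<pi>. x \<le> a + s * b" if "\<pi> \<in> parking_functions a b s" for \<pi> s
  proof (cases "s = 0")
    case True
    then show ?thesis using that by (simp add: parking_functions_alt)
  next
    case False
    then have "s - 1 < count_le (a + (s - 1) * b) \<pi>"
      using that unfolding parking_functions_alt by simp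
    also have "\<dots> \<le> count_le (a + s * b) \<pi>" by (rule count_le_mono) simp
    finally have "count_le (a + s * b) \<pi> = length \<pi>"
      using that length_filter_le[of "\<lambda>x. x \<le> a + s * b" \<pi>] unfolding parking_functions_alt by simp
    then show ?thesis by (metis length_filter_less less_irrefl)
  qed
  have Z: "card (Z s) = (n choose s) * card (parking_functions a b s) * card (B s)"
          "finite (Z s)" if s: "s \<in> R" for s
  proof -
    have n: "s + (n - s) = n" using s assms(1) by auto
    have 1: "\<And>xs. xs \<in> parking_functions a b s \<Longrightarrow> length xs = s \<and> (\<forall>x\<in>set xs. x \<le> a + s * b)"
      using sub parking_functions_alt by blast
    have 2: "\<And>ys. ys \<in> B s \<Longrightarrow> length ys = n - s \<and> (\<forall>y\<in>set ys. \<not> y \<le> a + s * b)"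
      using B[OF s] by (simp add: not_le)
    note split = card_filter_split[OF finite_parking_functions[of a b s] fin[OF s],
      of s "\<lambda>x. x \<le> a + s * b" "n - s", OF 1 2]
    show "card (Z s) = (n choose s) * card (parking_functions a b s) * card (B s)"
      using split(1) unfolding n Z_def .
    show "finite (Z s)" using split(2) unfolding Z_def .
  qed
  have ff: "first_failure a b s zs" if "s \<in> R" "zs \<in> Z s" for s zs
  proof -
    have "\<forall>x\<in>set zs. 1 \<le> x"
      unfolding all_iff_filters[of zs _ "\<lambda>x. x \<le> a + s * b"]
      using that B[OF that(1)] unfolding Z_def parking_functions_def by fastforce
    then show ?thesis using that unfolding Z_def by (simp add: filter_parking_iff)
  qed
  have "{zs. \<exists>s\<in>R. filter (\<lambda>x. x \<le> a + s * b) zs \<in> parking_functions a b s \<and>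
                          filter (\<lambda>x. \<not> x \<le> a + s * b) zs \<in> B s} = (\<Union>s\<in>R. Z s)"
    unfolding Z_def by auto
  also have "card \<dots> = (\<Sum>s\<in>R. card (Z s))"
  proof (rule card_UN_disjoint)
    show "finite R" using assms(1) finite_subset by blast
    show "\<forall>s\<in>R. finite (Z s)" using Z by blast
    show "\<forall>s\<in>R. \<forall>s'\<in>R. s \<noteq> s' \<longrightarrow> Z s \<inter> Z s' = {}"
      using ff first_failure_unique by blast
  qed
  finally show ?thesis using Z by simp
qed

text \<open>
  A recursion that determines the number of parking functions: the summand \<open>s = m\<close> is this
  number itself, the others involve shorter parking functions.
\<close>

lemma words_by_first_failure:
  assumes "a + m * b \<le> X"
  shows "X ^ m = (\<Sum>s\<le>m. (m choose s) * card (parking_functions a b s) * (X - (a + s * b)) ^ (m - s))"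
proof -
  let ?B = "\<lambda>s. {ys. set ys \<subseteq> {a + s * b<..X} \<and> length ys = m - s}"
  have le: "a + s * b \<le> X" if "s \<le> m" for s
    using assms mult_le_mono1[OF that, of b] by linarith
  have "{zs. set zs \<subseteq> {1..X} \<and> length zs = m} =
    {zs. \<exists>s\<in>{..m}. filter (\<lambda>x. x \<le> a + s * b) zs \<in> parking_functions a b s \<and>
                    filter (\<lambda>x. \<not> x \<le> a + s * b) zs \<in> ?B s}" (is "?L = ?R")
  proof (intro set_eqI iffI)
    fix zs assume zs: "zs \<in> ?L"
    then obtain s where s: "s \<le> m" "first_failure a b s zs"
      using first_failure_exists[of zs a b] by auto
    have "length (filter (\<lambda>x. \<not> x \<le> a + s * b) zs) = m - s"
      using s(2) zs sum_length_filter_compl[of "\<lambda>x. x \<le> a + s * b" zs]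
      unfolding first_failure_def by simp
    then show "zs \<in> ?R"
      using zs s filter_parking_iff[of zs a s b] by fastforce
  next
    fix zs assume "zs \<in> ?R"
    then obtain s where s: "s \<le> m" "filter (\<lambda>x. x \<le> a + s * b) zs \<in> parking_functions a b s"
      "filter (\<lambda>x. \<not> x \<le> a + s * b) zs \<in> ?B s" by auto
    have "length zs = m"
      using s sum_length_filter_compl[of "\<lambda>x. x \<le> a + s * b" zs]
      by (simp add: parking_functions_def)
    moreover have "\<forall>x\<in>set zs. 1 \<le> x \<and> x \<le> X"
      unfolding all_iff_filters[of zs _ "\<lambda>x. x \<le> a + s * b"]
      using s le[OF s(1)] unfolding parking_functions_def by fastforce
    ultimately show "zs \<in> ?L" by auto
  qed
  then have "card ?L = (\<Sum>s\<le>m. (m choose s) * card (parking_functions a b s) * card (?B s))"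
    by (simp only:) (rule card_by_first_failure, auto simp: finite_lists_length_eq)
  then show ?thesis by (simp add: card_lists_length_eq)
qed

text \<open>
  The first entry \<open>a + n * b - j\<close> counts only at the thresholds with index at least
  \<open>n - j div b\<close>. So the remaining \<open>n\<close> entries satisfy the full parking condition at the
  lower indices, while from there on the condition is weaker by one. Let the full condition
  fail first at \<open>s\<close>; then \<open>s \<ge> n - j div b\<close>, exactly \<open>s\<close> entries are small, and the weakened
  condition at the later thresholds is the parking condition with \<open>a = b\<close> for the large entries
  lowered by \<open>a + s * b\<close>.
\<close>

lemma parking_with_first_entry:
  assumes "1 \<le> a" "1 \<le> b" "j \<le> n * b"
  shows "{xs. (a + n * b - j) # xs \<in> parking_functions a b (Suc n)} =
    {xs. \<exists>s\<in>{n - j div b..n}. filter (\<lambda>x. x \<le> a + s * b) xs \<in> parking_functions a b s \<and>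
                filter (\<lambda>x. \<not> x \<le> a + s * b) xs \<in> map (\<lambda>y. a + s * b + y) ` parking_functions b b (n - s)}"
    (is "?L = ?R")
proof -
  let ?v = "a + n * b - j"
  have v1: "1 \<le> ?v" using assms by simp
  have v_le: "?v \<le> a + t * b \<longleftrightarrow> n - j div b \<le> t" for t
  proof -
    have "?v \<le> a + t * b \<longleftrightarrow> n * b \<le> t * b + j" using assms(3) by linarith
    also have "\<dots> \<longleftrightarrow> (n - t) * b \<le> j" by (simp add: diff_mult_distrib le_diff_conv add.commute)
    also have "\<dots> \<longleftrightarrow> n - t \<le> j div b" using assms(2) by (simp add: less_eq_div_iff_mult_less_eq)
    finally show ?thesis by linarith
  qed
  have L: "xs \<in> ?L \<longleftrightarrow> length xs = n \<and> (\<forall>x\<in>set xs. 1 \<le> x) \<and>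
      (\<forall>t\<le>n. t < count_le (a + t * b) xs \<or> (n - j div b \<le> t \<and> t \<le> count_le (a + t * b) xs))" for xs
  proof -
    have "t < count_le (a + t * b) (?v # xs) \<longleftrightarrow>
        t < count_le (a + t * b) xs \<or> (n - j div b \<le> t \<and> t \<le> count_le (a + t * b) xs)" for t
      unfolding filter.simps v_le by (cases "n - j div b \<le> t") (simp_all add: less_Suc_eq_le le_less)
    moreover have "xs \<in> ?L \<longleftrightarrow> length xs = n \<and> (\<forall>x\<in>set xs. 1 \<le> x) \<and>
        (\<forall>t\<le>n. t < count_le (a + t * b) (?v # xs))"
      using v1 unfolding parking_functions_alt
      by (auto simp: less_Suc_eq_le simp del: filter.simps)
    ultimately show ?thesis by (simp only:)
  qed
  \<comment> \<open>The index \<open>q\<close> in the parking condition of the lowered entries is \<open>t - s - 1\<close>: the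
    threshold \<open>b + q * b\<close> becomes \<open>a + (s + Suc q) * b\<close> before the shift, and all \<open>s\<close> small
    entries lie under it.\<close>
  have large: "filter (\<lambda>x. \<not> x \<le> a + s * b) xs \<in> map (\<lambda>y. a + s * b + y) ` parking_functions b b (n - s)
      \<longleftrightarrow> (\<forall>t\<in>{s<..n}. t \<le> count_le (a + t * b) xs)"
    if "length xs = n" "s \<le> n" "count_le (a + s * b) xs = s" for xs s
  proof -
    define ys where "ys = filter (\<lambda>x. \<not> x \<le> a + s * b) xs"
    define zs where "zs = map (\<lambda>x. x - (a + s * b)) ys"
    have ys: "length ys = n - s" "\<forall>y\<in>set ys. a + s * b < y"
      using that sum_length_filter_compl[of "\<lambda>x. x \<le> a + s * b" xs] unfolding ys_def by auto
    have ys_zs: "ys = map (\<lambda>y. a + s * b + y) zs"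
      unfolding zs_def map_map by (rule map_idI[symmetric]) (use ys(2) in auto)
    have zs: "length zs = n - s" "\<forall>z\<in>set zs. 1 \<le> z"
      using ys unfolding zs_def by (auto simp: Suc_le_eq)
    have "ys \<in> map (\<lambda>y. a + s * b + y) ` parking_functions b b (n - s) \<longleftrightarrow> zs \<in> parking_functions b b (n - s)"
      unfolding ys_zs by (simp add: inj_image_mem_iff inj_def inj_map_eq_map)
    also have "\<dots> \<longleftrightarrow> (\<forall>q<n - s. q < count_le (b + q * b) zs)"
      using zs unfolding parking_functions_alt by blast
    also have "\<dots> \<longleftrightarrow> (\<forall>q<n - s. s + Suc q \<le> count_le (a + (s + Suc q) * b) xs)"
    proof (intro all_cong1 imp_cong refl)
      fix q assume "q < n - s"
      have "count_le (a + (s + Suc q) * b) xs =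
          count_le (a + (s + Suc q) * b) (filter (\<lambda>x. x \<le> a + s * b) xs) + count_le (a + (s + Suc q) * b) ys"
        unfolding ys_def by (induction xs) auto
      also have "filter (\<lambda>x. x \<le> a + (s + Suc q) * b) (filter (\<lambda>x. x \<le> a + s * b) xs) = filter (\<lambda>x. x \<le> a + s * b) xs"
      proof (rule filter_True, clarify)
        fix x assume "x \<in> set (filter (\<lambda>x. x \<le> a + s * b) xs)"
        moreover have "s * b \<le> (s + Suc q) * b" by (intro mult_le_mono1) simp
        ultimately show "x \<le> a + (s + Suc q) * b" by simp
      qed
      also have "count_le (a + (s + Suc q) * b) ys = count_le (b + q * b) zs"
        unfolding ys_zs by (simp add: filter_map o_def algebra_simps)
      finally show "(q < count_le (b + q * b) zs) = (s + Suc q \<le> count_le (a + (s + Suc q) * b) xs)"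
        using that by (simp add: Suc_le_eq)
    qed
    also have "\<dots> \<longleftrightarrow> (\<forall>t\<in>{s<..n}. t \<le> count_le (a + t * b) xs)"
    proof
      assume *: "\<forall>q<n - s. s + Suc q \<le> count_le (a + (s + Suc q) * b) xs"
      show "\<forall>t\<in>{s<..n}. t \<le> count_le (a + t * b) xs"
      proof
        fix t assume t: "t \<in> {s<..n}"
        then have "t = s + Suc (t - s - 1)" by auto
        then show "t \<le> count_le (a + t * b) xs" using *[rule_format, of "t - s - 1"] t by auto
      qed
    next
      assume *: "\<forall>t\<in>{s<..n}. t \<le> count_le (a + t * b) xs"
      show "\<forall>q<n - s. s + Suc q \<le> count_le (a + (s + Suc q) * b) xs"
      proof (intro allI impI)
        fix q assume "q < n - s"
        then have "s + Suc q \<in> {s<..n}" by auto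
        then show "s + Suc q \<le> count_le (a + (s + Suc q) * b) xs" using * by blast
      qed
    qed
    finally show ?thesis unfolding ys_def .
  qed
  have "xs \<in> ?L \<longleftrightarrow> xs \<in> ?R" for xs
  proof
    assume "xs \<in> ?L"
    then have xs: "length xs = n" "\<forall>x\<in>set xs. 1 \<le> x"
      "\<And>t. t \<le> n \<Longrightarrow> t < count_le (a + t * b) xs \<or> (n - j div b \<le> t \<and> t \<le> count_le (a + t * b) xs)"
      using L by auto
    obtain s where s: "s \<le> n" "first_failure a b s xs"
      using first_failure_exists[of xs a b] xs by auto
    then have cs: "count_le (a + s * b) xs = s" unfolding first_failure_def by simp
    then have "n - j div b \<le> s" using xs(3)[OF s(1)] by simp
    moreover have "\<forall>t\<in>{s<..n}. t \<le> count_le (a + t * b) xs"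
      using xs(3) by (meson greaterThanAtMost_iff less_imp_le)
    ultimately show "xs \<in> ?R"
      using s large[OF xs(1) s(1) cs] filter_parking_iff[OF xs(2), of a s b] by auto
  next
    assume "xs \<in> ?R"
    then obtain s where s: "n - j div b \<le> s" "s \<le> n"
      and small: "filter (\<lambda>x. x \<le> a + s * b) xs \<in> parking_functions a b s"
      and big: "filter (\<lambda>x. \<not> x \<le> a + s * b) xs \<in> map (\<lambda>y. a + s * b + y) ` parking_functions b b (n - s)"
      by auto
    have pos: "\<forall>x\<in>set xs. 1 \<le> x"
      unfolding all_iff_filters[of xs _ "\<lambda>x. x \<le> a + s * b"]
      using small big unfolding parking_functions_def by fastforce
    have ff: "first_failure a b s xs" using small pos by (simp add: filter_parking_iff)
    then have cs: "count_le (a + s * b) xs = s" unfolding first_failure_def by simp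
    have "length (filter (\<lambda>x. \<not> x \<le> a + s * b) xs) = n - s"
      using big by (auto simp: parking_functions_def)
    then have len: "length xs = n"
      using cs s sum_length_filter_compl[of "\<lambda>x. x \<le> a + s * b" xs] by simp
    have "\<forall>t\<in>{s<..n}. t \<le> count_le (a + t * b) xs" using big large[OF len s(2) cs] by simp
    then have "t < count_le (a + t * b) xs \<or> (n - j div b \<le> t \<and> t \<le> count_le (a + t * b) xs)" if "t \<le> n" for t
      using ff s cs that unfolding first_failure_def
      by (cases t s rule: linorder_cases) auto
    then show "xs \<in> ?L" using L len pos by blast
  qed
  then show ?thesis by blast
qed

lemma card_parking_with_first_entry:
  assumes "1 \<le> a" "1 \<le> b" "j \<le> n * b"
  shows "card {\<pi> \<in> parking_functions a b (Suc n). \<pi> ! 0 = a + n * b - j} =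
    (\<Sum>s=n - j div b..n. (n choose s) * card (parking_functions a b s) * card (parking_functions b b (n - s)))"
proof -
  let ?E = "{xs. (a + n * b - j) # xs \<in> parking_functions a b (Suc n)}"
  have "{\<pi> \<in> parking_functions a b (Suc n). \<pi> ! 0 = a + n * b - j} = Cons (a + n * b - j) ` ?E"
  proof (intro set_eqI iffI)
    fix \<pi> assume \<pi>: "\<pi> \<in> {\<pi> \<in> parking_functions a b (Suc n). \<pi> ! 0 = a + n * b - j}"
    then have "length \<pi> = Suc n" by (simp add: parking_functions_def)
    then obtain v xs where "\<pi> = v # xs" by (auto simp: length_Suc_conv)
    with \<pi> have "\<pi> = (a + n * b - j) # xs" "xs \<in> ?E" by auto
    then show "\<pi> \<in> Cons (a + n * b - j) ` ?E" by (rule image_eqI)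
  qed auto
  then have "card {\<pi> \<in> parking_functions a b (Suc n). \<pi> ! 0 = a + n * b - j} = card ?E"
    by (simp add: card_image)
  also have "\<dots> = (\<Sum>s\<in>{n - j div b..n}. (n choose s) * card (parking_functions a b s) *
      card (map (\<lambda>y. a + s * b + y) ` parking_functions b b (n - s)))"
    unfolding parking_with_first_entry[OF assms]
  proof (rule card_by_first_failure)
    fix s ys assume "s \<in> {n - j div b..n}" "ys \<in> map (\<lambda>y. a + s * b + y) ` parking_functions b b (n - s)"
    then show "length ys = n - s \<and> (\<forall>y\<in>set ys. a + s * b < y)"
      by (auto simp: parking_functions_def Suc_le_eq)
  qed (auto intro!: finite_imageI finite_parking_functions)
  also have "\<dots> = (\<Sum>s=n - j div b..n. (n choose s) * card (parking_functions a b s) * card (parking_functions b b (n - s)))"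
  proof -
    have "card (map (\<lambda>y. a + s * b + y) ` P) = card P" for s P
      by (intro card_image inj_on_subset[OF inj_mapI subset_UNIV]) (simp add: inj_def)
    then show ?thesis by simp
  qed
  finally show ?thesis .
qed

section \<open>Finite differences and Abel's identity\<close>

text \<open>
  An \<open>n\<close>-th finite difference kills polynomials of degree below \<open>n\<close>. The induction removes
  one factor \<open>x + k * z\<close> at a time: the part \<open>x\<close> only lowers the degree, and in the part
  \<open>k * z\<close> the factor \<open>k\<close> is absorbed into the binomial coefficient, which lowers \<open>n\<close> along
  with the degree.
\<close>

lemma alternating_binomial_power_sum:
  fixes x z :: "'a::comm_ring_1"
  shows "d < n \<Longrightarrow> (\<Sum>k\<le>n. (-1) ^ k * of_nat (n choose k) * (x + of_nat k * z) ^ d) = 0"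
proof (induction d arbitrary: n x)
  case 0
  then show ?case by (simp add: choose_alternating_sum)
next
  case (Suc d)
  then obtain p where n: "n = Suc p" "d < p" by (cases n) auto
  let ?T = "\<lambda>k. (-1) ^ k * of_nat (n choose k) * (x + of_nat k * z) ^ d"
  have "(\<Sum>k\<le>n. (-1) ^ k * of_nat (n choose k) * (x + of_nat k * z) ^ Suc d) =
        (\<Sum>k\<le>n. x * ?T k + z * (of_nat k * ?T k))"
    by (intro sum.cong refl) (simp add: algebra_simps)
  also have "\<dots> = x * (\<Sum>k\<le>n. ?T k) + z * (\<Sum>k\<le>n. of_nat k * ?T k)"
    by (simp add: sum.distrib sum_distrib_left)
  also have "(\<Sum>k\<le>n. ?T k) = 0" using Suc by simp
  also have "(\<Sum>k\<le>n. of_nat k * ?T k) = (\<Sum>k\<le>p. of_nat (Suc k) * ?T (Suc k))"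
    unfolding n by (subst sum.atMost_Suc_shift) simp
  also have "\<dots> = (\<Sum>k\<le>p. - of_nat n * ((-1) ^ k * of_nat (p choose k) * ((x + z) + of_nat k * z) ^ d))"
  proof (intro sum.cong refl)
    fix k
    have absorb: "of_nat (Suc k) * of_nat (n choose Suc k) = of_nat n * (of_nat (p choose k) :: 'a)"
      unfolding n using Suc_times_binomial_eq[of p k] by (metis mult.commute of_nat_mult)
    have shift: "x + of_nat (Suc k) * z = (x + z) + of_nat k * z" by (simp add: algebra_simps)
    have "of_nat (Suc k) * ?T (Suc k) =
        (-1) ^ Suc k * (of_nat (Suc k) * of_nat (n choose Suc k)) * (x + of_nat (Suc k) * z) ^ d"
      by (simp only: mult_ac)
    also have "\<dots> = - of_nat n * ((-1) ^ k * of_nat (p choose k) * ((x + z) + of_nat k * z) ^ d)"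
      unfolding absorb shift by (simp add: mult_ac)
    finally show "of_nat (Suc k) * ?T (Suc k) = \<dots>" .
  qed
  also have "\<dots> = - of_nat n * (\<Sum>k\<le>p. (-1) ^ k * of_nat (p choose k) * ((x + z) + of_nat k * z) ^ d)"
    by (simp only: sum_distrib_left)
  also have "\<dots> = 0" using Suc.IH[OF n(2)] by simp
  finally show ?case by simp
qed

text \<open>
  Abel's generalisation of the binomial theorem. Differentiating the identity for \<open>Suc m\<close> in
  \<open>X\<close> gives \<open>Suc m\<close> times the identity for \<open>m\<close>, so it suffices to compare both sides at
  \<open>X = 0\<close>, where a finite difference of a polynomial of too small degree appears. The
  coefficient is written as a quotient, so that \<open>s = 0\<close>, with value \<open>1\<close>, is not a special case.
\<close>

lemma abel_identity:
  fixes a b X :: real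
  assumes "0 < a" "0 \<le> b"
  shows "X ^ m = (\<Sum>s\<le>m. real (m choose s) * (a * (a + real s * b) ^ s / (a + real s * b)) * (X - (a + real s * b)) ^ (m - s))"
proof (induction m arbitrary: X)
  case 0
  then show ?case using assms by simp
next
  case (Suc m)
  let ?w = "\<lambda>s. a + real s * b"
  let ?c = "\<lambda>s. a * ?w s ^ s / ?w s"
  let ?f = "\<lambda>X. (\<Sum>s\<le>Suc m. real (Suc m choose s) * ?c s * (X - ?w s) ^ (Suc m - s)) - X ^ Suc m"
  have w: "?w s > 0" for s using assms by (simp add: add_pos_nonneg)
  have deriv: "((\<lambda>X. K * (X - u) ^ p) has_real_derivative K * (real p * (Y - u) ^ (p - 1))) (at Y)"
    for K u Y :: real and p
    by (auto intro!: derivative_eq_intros)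
  \<comment> \<open>The difference of the two sides is constant in \<open>X\<close>.\<close>
  have "(?f has_real_derivative 0) (at Y)" for Y
  proof -
    have "(?f has_real_derivative (\<Sum>s\<le>Suc m. real (Suc m choose s) * ?c s *
        (real (Suc m - s) * (Y - ?w s) ^ (Suc m - s - 1))) - real (Suc m) * Y ^ m) (at Y)"
      using DERIV_pow[of "Suc m" Y UNIV] by (intro DERIV_diff DERIV_sum deriv) simp
    also have "(\<Sum>s\<le>Suc m. real (Suc m choose s) * ?c s * (real (Suc m - s) * (Y - ?w s) ^ (Suc m - s - 1))) =
       (\<Sum>s\<le>m. real (Suc m choose s) * ?c s * (real (Suc m - s) * (Y - ?w s) ^ (Suc m - s - 1)))"
      by simp
    also have "\<dots> = (\<Sum>s\<le>m. real (Suc m) * (real (m choose s) * ?c s * (Y - ?w s) ^ (m - s)))"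
    proof (intro sum.cong refl)
      fix s assume "s \<in> {..m}"
      then have "real (Suc m choose s) * real (Suc m - s) = real (Suc m) * real (m choose s)"
        using binomial_absorb_comp[of "Suc m" s] by (metis diff_Suc_1 mult.commute of_nat_mult)
      then show "real (Suc m choose s) * ?c s * (real (Suc m - s) * (Y - ?w s) ^ (Suc m - s - 1)) =
          real (Suc m) * (real (m choose s) * ?c s * (Y - ?w s) ^ (m - s))"
        by (simp del: binomial_Suc_Suc of_nat_Suc)
    qed
    also have "\<dots> = real (Suc m) * Y ^ m"
      unfolding sum_distrib_left[symmetric] Suc.IH[of Y, symmetric] ..
    finally show ?thesis by simp
  qed
  then have "?f X = ?f 0"
    by (intro DERIV_isconst_all) blast
  also have "?f 0 = (\<Sum>s\<le>Suc m. a * (-1) ^ Suc m * ((-1) ^ s * real (Suc m choose s) * ?w s ^ m))"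
  proof -
    have "real (Suc m choose s) * ?c s * (0 - ?w s) ^ (Suc m - s) =
        a * (-1) ^ Suc m * ((-1) ^ s * real (Suc m choose s) * ?w s ^ m)" if "s \<le> Suc m" for s
    proof -
      have "(0 - ?w s) ^ (Suc m - s) = (-1) ^ (Suc m - s) * ?w s ^ (Suc m - s)"
        by (metis diff_0 power_minus)
      moreover have "(-1::real) ^ (Suc m - s) = (-1) ^ Suc m * (-1) ^ s"
        using that by (simp add: power_diff_conv_inverse)
      moreover have "?w s ^ s * ?w s ^ (Suc m - s) = ?w s * ?w s ^ m"
        using that by (metis le_add_diff_inverse power_Suc power_add)
      ultimately show ?thesis using w[of s] by (simp add: field_simps del: binomial_Suc_Suc)
    qed
    then have "(\<Sum>s\<le>Suc m. real (Suc m choose s) * ?c s * (0 - ?w s) ^ (Suc m - s)) =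
        (\<Sum>s\<le>Suc m. a * (-1) ^ Suc m * ((-1) ^ s * real (Suc m choose s) * ?w s ^ m))"
      by (intro sum.cong refl) simp
    then show ?thesis by (simp only: power_0_Suc diff_zero)
  qed
  also have "\<dots> = 0"
    using alternating_binomial_power_sum[of m "Suc m" a b]
    by (simp only: sum_distrib_left[symmetric] lessI mult_zero_right)
  finally show ?case by linarith
qed

section \<open>The number of parking functions\<close>

text \<open>
  For \<open>m \<ge> 1\<close> this is \<open>a * (a + m * b) ^ (m - 1)\<close>; the quotient also covers \<open>m = 0\<close>. Words over the alphabet \<open>{1..a + m * b}\<close> yield the
  recursion that Abel's identity solves.
\<close>

lemma card_parking_functions:
  assumes "1 \<le> a"
  shows "real (card (parking_functions a b m)) = real a * (real a + real m * real b) ^ m / (real a + real m * real b)"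
proof (induction m rule: less_induct)
  case (less m)
  let ?w = "\<lambda>s. real a + real s * real b"
  have assms_pos: "0 < real a" using assms by simp
  have nat: "real (a + m * b - (a + s * b)) = ?w m - ?w s" if "s \<le> m" for s
    using that by (simp add: of_nat_diff)
  have "?w m ^ m = real ((a + m * b) ^ m)" by simp
  also have "\<dots> = (\<Sum>s\<le>m. real (m choose s) * real (card (parking_functions a b s)) * (?w m - ?w s) ^ (m - s))"
    unfolding words_by_first_failure[of a m b, OF order_refl]
    by (simp only: of_nat_sum of_nat_mult of_nat_power) (intro sum.cong refl, simp only: nat atMost_iff)
  also have "\<dots> = (\<Sum>s<m. real (m choose s) * real (card (parking_functions a b s)) * (?w m - ?w s) ^ (m - s))
      + real (card (parking_functions a b m))"
    by (simp add: lessThan_Suc_atMost[symmetric])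
  also have "(\<Sum>s<m. real (m choose s) * real (card (parking_functions a b s)) * (?w m - ?w s) ^ (m - s))
      = (\<Sum>s<m. real (m choose s) * (real a * ?w s ^ s / ?w s) * (?w m - ?w s) ^ (m - s))"
    using less by simp
  finally have "?w m ^ m = (\<Sum>s<m. real (m choose s) * (real a * ?w s ^ s / ?w s) * (?w m - ?w s) ^ (m - s))
      + real (card (parking_functions a b m))" .
  moreover have "?w m ^ m = (\<Sum>s<m. real (m choose s) * (real a * ?w s ^ s / ?w s) * (?w m - ?w s) ^ (m - s))
      + real a * ?w m ^ m / ?w m"
    using abel_identity[of "real a" "real b" "?w m" m, OF assms_pos of_nat_0_le_iff]
    unfolding lessThan_Suc_atMost[symmetric] sum.lessThan_Suc by simp
  ultimately show ?case by linarith
qed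

section \<open>Total mass of the Borel distribution\<close>

text \<open>
  The coefficients \<open>n ^ (n - 1) / n!\<close> of Cayley's tree function \<open>T\<close>. Up to the factor \<open>\<mu>\<close>
  the Borel masses are the terms of the series for \<open>T\<close> at \<open>\<mu> * exp (- \<mu>)\<close>.
\<close>

definition tree_coeff :: "nat \<Rightarrow> real" where
  "tree_coeff n = (if n = 0 then 0 else real n ^ (n - 1) / fact n)"

lemma borel_mass_tree_coeff:
  "\<mu> \<noteq> 0 \<Longrightarrow> borel_mass \<mu> n = tree_coeff n * (\<mu> * exp (- \<mu>)) ^ n / \<mu>"
proof (cases n)
  case (Suc k)
  assume "\<mu> \<noteq> 0"
  moreover have "exp (- \<mu> * real n) = exp (- \<mu>) ^ n"
    by (simp add: mult.commute flip: exp_of_nat_mult)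
  moreover have "\<mu> ^ n = \<mu> * \<mu> ^ k" by (simp add: Suc)
  ultimately show ?thesis
    by (simp add: borel_mass_def tree_coeff_def power_mult_distrib Suc del: of_nat_Suc power_Suc fact_Suc)
qed (simp add: borel_mass_def tree_coeff_def)

lemma tree_coeff_nonneg: "0 \<le> tree_coeff n"
  by (simp add: tree_coeff_def)

lemma power_div_fact_le_exp: "0 \<le> x \<Longrightarrow> x ^ n / fact n \<le> exp (x::real)"
  using sum_le_suminf[OF summable_exp_generic[of x], of "{n}"]
  by (simp add: exp_def divide_inverse mult.commute)

lemma tree_coeff_le: "tree_coeff n \<le> exp 1 ^ n"
proof (cases n)
  case (Suc k)
  have "tree_coeff n \<le> real n ^ n / fact n"
    unfolding tree_coeff_def Suc by (simp add: divide_right_mono mult_left_le_one_le field_simps)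
  also have "\<dots> \<le> exp (real n)" by (rule power_div_fact_le_exp) simp
  also have "\<dots> = exp 1 ^ n" by (simp flip: exp_of_nat_mult)
  finally show ?thesis .
qed (simp add: tree_coeff_def)

lemma summable_tree_coeff:
  assumes "0 \<le> t" "t < exp (-1)"
  shows "summable (\<lambda>n. tree_coeff n * t ^ n)"
proof (rule summable_comparison_test)
  have "exp 1 * t < 1" using assms by (simp add: exp_minus field_simps)
  then show "summable (\<lambda>n. (exp 1 * t) ^ n)" using assms by (intro summable_geometric) auto
  have "norm (tree_coeff n * t ^ n) \<le> (exp 1 * t) ^ n" for n
    using assms tree_coeff_le[of n] tree_coeff_nonneg[of n]
    by (simp add: abs_mult power_mult_distrib mult_right_mono)
  then show "\<exists>N. \<forall>n\<ge>N. norm (tree_coeff n * t ^ n) \<le> (exp 1 * t) ^ n" by blast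
qed

definition tree_fps :: "complex fps" where
  "tree_fps = Abs_fps (\<lambda>n. complex_of_real (tree_coeff n))"

lemma tree_fps_conv_radius: "fps_conv_radius tree_fps \<ge> exp (-1)"
  unfolding fps_conv_radius_def
proof (rule conv_radius_geI_ex')
  fix r :: real assume "0 < r" "ereal r < ereal (exp (-1))"
  then have "summable (\<lambda>n. complex_of_real (tree_coeff n * r ^ n))"
    using summable_tree_coeff[of r] by (simp only: summable_complex_of_real) simp
  then show "summable (\<lambda>n. fps_nth tree_fps n * complex_of_real r ^ n)"
    by (simp add: tree_fps_def)
qed

text \<open>
  The formal version of \<open>T (z * exp (- z)) = z\<close>. The coefficient of \<open>z ^ N\<close> is a finite
  difference of order \<open>N\<close> of the power \<open>N - 1\<close>, hence zero for \<open>N \<ge> 2\<close>.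
\<close>

lemma tree_fps_compose: "fps_compose tree_fps (fps_X * fps_exp (-1)) = fps_X"
proof (rule fps_ext)
  fix N
  have "fps_nth (fps_compose tree_fps (fps_X * fps_exp (-1))) N =
      (\<Sum>i=0..N. complex_of_real (tree_coeff i) * fps_nth (fps_X ^ i * fps_exp (- of_nat i)) N)"
    by (simp add: fps_compose_nth tree_fps_def power_mult_distrib fps_exp_power_mult)
  also have "\<dots> = (\<Sum>i\<le>N. complex_of_real (tree_coeff i) * ((- of_nat i) ^ (N - i) / fact (N - i)))"
    by (intro sum.cong) (auto simp: fps_X_power_mult_nth)
  also have "\<dots> = fps_nth fps_X N"
  proof (cases "N \<le> 1")
    case True
    then consider "N = 0" | "N = 1" by linarith
    then show ?thesis by cases (simp_all add: tree_coeff_def)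
  next
    case False
    have "complex_of_real (tree_coeff i) * ((- of_nat i) ^ (N - i) / fact (N - i)) =
        (-1) ^ N / fact N * ((-1) ^ i * of_nat (N choose i) * (0 + of_nat i * 1) ^ (N - 1))" if "i \<le> N" for i
    proof (cases i)
      case 0
      then show ?thesis using False by (simp add: tree_coeff_def)
    next
      case (Suc l)
      have "(- of_nat i :: complex) ^ (N - i) = (-1) ^ N * (-1) ^ i * of_nat i ^ (N - i)"
        by (subst power_minus) (use that in \<open>simp add: power_diff_conv_inverse\<close>)
      moreover have "(of_nat i :: complex) ^ (i - 1) * of_nat i ^ (N - i) = of_nat i ^ (N - 1)"
        using that Suc by (simp flip: power_add)
      moreover have "(of_nat (N choose i) :: complex) = fact N / (fact i * fact (N - i))"
        using that by (rule binomial_fact)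
      ultimately show ?thesis using Suc by (simp add: tree_coeff_def field_simps)
    qed
    then have "(\<Sum>i\<le>N. complex_of_real (tree_coeff i) * ((- of_nat i) ^ (N - i) / fact (N - i))) =
       (-1) ^ N / fact N * (\<Sum>i\<le>N. (-1) ^ i * of_nat (N choose i) * (0 + of_nat i * 1) ^ (N - 1))"
      unfolding sum_distrib_left by (intro sum.cong) auto
    also have "\<dots> = 0"
      using False alternating_binomial_power_sum[of "N - 1" N "0::complex" 1] by simp
    finally show ?thesis using False by simp
  qed
  finally show "fps_nth (fps_compose tree_fps (fps_X * fps_exp (-1))) N = fps_nth fps_X N" .
qed

text \<open>
  In the half plane \<open>Re z < 1\<close> the modulus of \<open>z * exp (- z)\<close> does not decrease along rays from
  the origin; this makes the domain of the next lemma star-shaped.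
\<close>

lemma starlike_mult_exp_bound:
  fixes x s :: real
  assumes "x \<le> 1" "0 \<le> s" "s \<le> 1"
  shows "s * exp (- (s * x)) \<le> exp (- x)"
proof -
  have "s \<le> 1 + (- ((1 - s) * x))"
    using assms mult_left_mono[of x 1 "1 - s"] by simp
  also have "\<dots> \<le> exp (- ((1 - s) * x))" by (rule exp_ge_add_one_self)
  finally have "s * exp (- (s * x)) \<le> exp (- ((1 - s) * x)) * exp (- (s * x))" by simp
  also have "\<dots> = exp (- x)" by (simp add: algebra_simps flip: exp_add)
  finally show ?thesis .
qed

text \<open>
  The formal identity gives the claim near the origin only, whereas real arguments up to \<open>1\<close>
  are wanted. Both sides are holomorphic on the set of all \<open>z\<close> with \<open>Re z < 1\<close> for which
  \<open>z * exp (- z)\<close> lies in the disc of convergence. This set is star-shaped around \<open>0\<close>, so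
  the identity extends by analytic continuation.
\<close>

lemma tree_fps_inverse:
  assumes "Re z < 1" "norm (z * exp (- z)) < exp (-1)"
  shows "eval_fps tree_fps (z * exp (- z)) = z"
proof -
  define A where "A = {z. Re z < 1} \<inter> {z::complex. norm (z * exp (- z)) < exp (-1)}"
  have "open A" unfolding A_def
    by (intro open_Int open_Collect_less continuous_intros)
  have "starlike A" unfolding starlike_def
  proof (intro bexI ballI subsetI)
    fix z w assume z: "z \<in> A" and "w \<in> closed_segment 0 z"
    then obtain s where s: "0 \<le> s" "s \<le> 1" "w = of_real s * z"
      by (auto simp: closed_segment_def scaleR_conv_of_real)
    have "Re w < 1"
    proof -
      have "s * Re z \<le> max 0 (Re z)"
        using s by (cases "Re z \<ge> 0") (auto simp: mult_left_le_one_le mult_nonneg_nonpos)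
      then show ?thesis using z s by (auto simp: A_def)
    qed
    moreover have "norm (w * exp (- w)) = norm z * (s * exp (- (s * Re z)))"
      using s by (simp add: norm_mult)
    moreover have "\<dots> \<le> norm z * exp (- Re z)"
      using z s by (intro mult_left_mono starlike_mult_exp_bound) (auto simp: A_def)
    moreover have "\<dots> < exp (-1)" using z by (simp add: A_def norm_mult)
    ultimately show "w \<in> A" unfolding A_def by simp
  qed (simp add: A_def)
  then have "connected A" by (rule starlike_imp_connected)
  have rad: "z * exp (- z) \<in> eball 0 (fps_conv_radius tree_fps)" if "z \<in> A" for z
  proof -
    have "ereal (norm (z * exp (- z))) < ereal (exp (-1))" using that by (simp add: A_def)
    also have "\<dots> \<le> fps_conv_radius tree_fps" by (rule tree_fps_conv_radius)
    finally show ?thesis by (simp add: in_eball_iff)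
  qed
  have "(eval_fps tree_fps \<circ> (\<lambda>z. z * exp (- z))) has_fps_expansion fps_compose tree_fps (fps_X * fps_exp (-1))"
  proof (rule has_fps_expansion_compose)
    have "0 < ereal (exp (-1))" by simp
    also have "\<dots> \<le> fps_conv_radius tree_fps" by (rule tree_fps_conv_radius)
    finally show "eval_fps tree_fps has_fps_expansion tree_fps" by (rule eval_fps_has_fps_expansion)
    show "(\<lambda>z::complex. z * exp (- z)) has_fps_expansion fps_X * fps_exp (-1)"
      by (intro fps_expansion_intros)
  qed simp
  then have "(\<lambda>z. eval_fps tree_fps (z * exp (- z)) - z) has_fps_expansion fps_X - fps_X"
    unfolding tree_fps_compose o_def by (intro fps_expansion_intros)
  moreover have "(\<lambda>z. eval_fps tree_fps (z * exp (- z)) - z) holomorphic_on A"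
  proof (intro holomorphic_intros)
    have "(eval_fps tree_fps \<circ> (\<lambda>z. z * exp (- z))) holomorphic_on A"
      by (rule holomorphic_on_compose_gen[OF _ holomorphic_on_eval_fps[OF order_refl]])
         (use rad in \<open>auto intro!: holomorphic_intros\<close>)
    then show "(\<lambda>z. eval_fps tree_fps (z * exp (- z))) holomorphic_on A" by (simp add: o_def)
  qed
  ultimately have "eval_fps tree_fps (z * exp (- z)) - z = 0"
    using assms \<open>open A\<close> \<open>connected A\<close>
    by (intro has_fps_expansion_0_analytic_continuation[of "\<lambda>z. eval_fps tree_fps (z * exp (- z)) - z" A z])
       (auto simp: A_def)
  then show ?thesis by simp
qed

lemma mult_exp_less:
  fixes \<mu> :: real
  assumes "0 < \<mu>" "\<mu> < 1"
  shows "\<mu> * exp (- \<mu>) < exp (-1)"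
proof -
  have "1 + (\<mu> - 1) < exp (\<mu> - 1)"
  proof -
    \<comment> \<open>Halving the exponent turns the weak tangent inequality into a strict one.\<close>
    have "1 + (\<mu> - 1) < (1 + (\<mu> - 1) / 2)\<^sup>2"
    proof -
      have "0 < ((\<mu> - 1) / 2)\<^sup>2" using assms by simp
      moreover have "(1 + (\<mu> - 1) / 2)\<^sup>2 = 1 + (\<mu> - 1) + ((\<mu> - 1) / 2)\<^sup>2"
        by (simp add: power2_eq_square field_simps)
      ultimately show ?thesis by linarith
    qed
    also have "\<dots> \<le> (exp ((\<mu> - 1) / 2))\<^sup>2"
      using assms by (intro power_mono exp_ge_add_one_self) (simp add: field_simps)
    also have "\<dots> = exp (\<mu> - 1)" by (simp flip: exp_of_nat_mult)
    finally show ?thesis .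
  qed
  then show ?thesis by (simp add: exp_diff exp_minus field_simps)
qed

lemma borel_mass_sums_subcritical:
  assumes "0 < \<mu>" "\<mu> < 1"
  shows "borel_mass \<mu> sums 1"
proof -
  let ?t = "\<mu> * exp (- \<mu>)"
  note t = mult_exp_less[OF assms]
  have "summable (\<lambda>n. tree_coeff n * ?t ^ n)" using assms t by (intro summable_tree_coeff) auto
  then have *: "(\<lambda>n. tree_coeff n * ?t ^ n) sums (\<Sum>n. tree_coeff n * ?t ^ n)" by (rule summable_sums)
  have "complex_of_real (\<Sum>n. tree_coeff n * ?t ^ n) = (\<Sum>n. complex_of_real (tree_coeff n * ?t ^ n))"
    using *[folded sums_of_real_iff[where 'a = complex]] by (rule sums_unique)
  also have "\<dots> = eval_fps tree_fps (complex_of_real ?t)"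
    by (simp add: eval_fps_def tree_fps_def)
  also have "complex_of_real ?t = of_real \<mu> * exp (- of_real \<mu>)"
    by (simp flip: exp_of_real)
  also have "eval_fps tree_fps \<dots> = of_real \<mu>"
    using assms t by (intro tree_fps_inverse) (simp_all add: norm_mult)
  finally have "(\<Sum>n. tree_coeff n * ?t ^ n) = \<mu>" by (simp only: of_real_eq_iff)
  with * have "(\<lambda>n. tree_coeff n * ?t ^ n / \<mu>) sums 1" using assms sums_divide[of _ \<mu> \<mu>] by auto
  then show ?thesis using assms by (simp add: borel_mass_tree_coeff cong: sums_cong)
qed

lemma borel_mass_nonneg: "0 \<le> \<mu> \<Longrightarrow> 0 \<le> borel_mass \<mu> n"
  by (simp add: borel_mass_def)

text \<open>
  The critical case \<open>\<mu> = 1\<close> lies on the boundary of the disc of convergence and is reached by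
  a limit from the left: each partial sum is continuous in \<open>\<mu>\<close>, so at most \<open>1\<close>, and the tree
  series has nonnegative terms, so its value at \<open>exp (-1)\<close> is at least each value \<open>\<nu> < 1\<close>
  that it takes at \<open>\<nu> * exp (- \<nu>)\<close>.
\<close>

lemma borel_mass_sums:
  assumes "0 < \<mu>" "\<mu> \<le> 1"
  shows "borel_mass \<mu> sums 1"
proof (cases "\<mu> < 1")
  case True
  then show ?thesis using borel_mass_sums_subcritical assms by blast
next
  case False
  have left: "\<forall>\<^sub>F \<nu> in at_left (1::real). 0 < \<nu> \<and> \<nu> < 1"
    by (rule eventually_at_leftI[of 0]) auto
  have partial: "(\<Sum>n<N. borel_mass 1 n) \<le> 1" for N
  proof (rule tendsto_upperbound)
    show "((\<lambda>\<nu>. \<Sum>n<N. borel_mass \<nu> n) \<longlongrightarrow> (\<Sum>n<N. borel_mass 1 n)) (at_left 1)"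
      unfolding borel_mass_def by (auto intro!: tendsto_eq_intros sum.cong)
    show "\<forall>\<^sub>F \<nu> in at_left 1. (\<Sum>n<N. borel_mass \<nu> n) \<le> 1"
      using left
    proof eventually_elim
      case (elim \<nu>)
      then show ?case
        using sum_le_suminf[OF sums_summable[OF borel_mass_sums_subcritical[of \<nu>]], of "{..<N}"]
          sums_unique[OF borel_mass_sums_subcritical[of \<nu>]] borel_mass_nonneg[of \<nu>] by simp
    qed
  qed simp
  have summ: "summable (borel_mass 1)"
    using partial by (intro bounded_imp_summable[where B = 1] borel_mass_nonneg)
      (simp_all only: lessThan_Suc_atMost[symmetric] zero_le_one)
  have "\<nu> \<le> (\<Sum>n. borel_mass 1 n)" if "0 < \<nu>" "\<nu> < 1" for \<nu>
  proof -
    have "(\<lambda>n. borel_mass \<nu> n * \<nu>) sums (1 * \<nu>)"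
      using borel_mass_sums_subcritical[OF that] by (rule sums_mult2)
    moreover have "borel_mass \<nu> n * \<nu> \<le> borel_mass 1 n" for n
      using that mult_exp_less[OF that] tree_coeff_nonneg[of n]
      by (simp add: borel_mass_tree_coeff) (intro mult_left_mono power_mono, auto)
    ultimately show ?thesis using sums_le[OF _ _ summable_sums[OF summ]] by force
  qed
  then have "1 \<le> (\<Sum>n. borel_mass 1 n)"
    by (metis dense_le_bounded zero_less_one)
  moreover have "(\<Sum>n. borel_mass 1 n) \<le> 1"
    using partial summ by (intro suminf_le_const) auto
  ultimately show ?thesis using False assms summ by (simp add: sums_iff)
qed

lemma borel_tail_eq:
  assumes "0 < \<mu>" "\<mu> \<le> 1"
  shows "1 - borel_tail \<mu> n = (\<Sum>i<n. borel_mass \<mu> i)"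
proof -
  let ?M = "borel_distribution \<mu>"
  have nn: "0 \<le> borel_mass \<mu> i" for i using borel_mass_nonneg assms by simp
  have sets: "sets ?M = UNIV" "space ?M = UNIV" by (simp_all add: borel_distribution_def)
  have em: "emeasure ?M A = (\<integral>\<^sup>+ i. ennreal (borel_mass \<mu> i) * indicator A i \<partial>count_space UNIV)" for A
    unfolding borel_distribution_def by (subst emeasure_density) auto
  have "emeasure ?M UNIV = (\<Sum>i. ennreal (borel_mass \<mu> i))"
    unfolding em by (simp add: nn_integral_count_space_nat)
  also have "\<dots> = 1"
    using borel_mass_sums[OF assms] nn by (subst suminf_ennreal_eq[of _ 1]) auto
  finally interpret prob_space ?M by (intro prob_spaceI) (simp add: sets)
  have "emeasure ?M {..<n} = (\<Sum>i<n. ennreal (borel_mass \<mu> i))"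
    unfolding em by (subst nn_integral_count_space'[of "{..<n}"]) (auto simp: indicator_def)
  also have "\<dots> = ennreal (\<Sum>i<n. borel_mass \<mu> i)" using nn by (simp add: sum_ennreal)
  finally have "prob {..<n} = (\<Sum>i<n. borel_mass \<mu> i)"
    using nn by (simp add: measure_def sum_nonneg)
  moreover have "prob {n..} = 1 - prob {..<n}"
    using prob_compl[of "{..<n}"] sets by (simp add: Compl_eq_Diff_UNIV[symmetric])
  ultimately show ?thesis unfolding borel_tail_def by simp
qed
section \<open>Asymptotics of the first entry\<close>

text \<open>
  The contribution to the probability of the parking functions whose last \<open>m - 1\<close> entries
  fail first at \<open>m - 1 - i\<close>, after cancelling the common factor \<open>a\<close>. Here \<open>Y\<close> is
  \<open>a + m * b\<close> and \<open>w\<close> is \<open>a + (m - 1 - i) * b\<close>; writing them through \<open>c\<close> makes the term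
  a function on all \<open>m\<close>, also where \<open>c * m\<close> is not an integer.
\<close>

definition first_entry_term :: "real \<Rightarrow> nat \<Rightarrow> nat \<Rightarrow> nat \<Rightarrow> real" where
  "first_entry_term c b i m =
     (let Y = (real b + c) * real m + real b; w = Y - real (Suc i) * real b in
      real (m - 1 choose i) * (w ^ (m - 1 - i) / w) * (real b ^ i * real (Suc i) ^ i / real (Suc i)) * (Y / Y ^ m))"

lemma prob_first_entry:
  fixes a b j m :: nat and c :: real
  assumes "1 \<le> b" "0 \<le> c" and a: "real a = c * real m + real b" and m: "j div b < m" "j < m"
  shows "measure_pmf.prob (pmf_of_set (parking_functions a b m))
           {\<pi>. int (\<pi> ! 0) = int a + (int m - 1) * int b - int j} =
         (\<Sum>i\<le>j div b. first_entry_term c b i m)"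
proof -
  obtain n where n: "m = Suc n" using m by (cases m) auto
  have "1 \<le> real a" using assms by (simp add: add_increasing)
  then have a1: "1 \<le> a" by simp
  have jn: "j \<le> n * b"
  proof -
    have "j \<le> n * 1" using m n by simp
    also have "\<dots> \<le> n * b" using assms(1) by (rule mult_le_mono2)
    finally show ?thesis .
  qed
  define Y where "Y = (real b + c) * real m + real b"
  have Y: "real a + real m * real b = Y" unfolding Y_def a by (simp add: algebra_simps)
  have ev: "(int (\<pi> ! 0) = int a + (int m - 1) * int b - int j) \<longleftrightarrow> \<pi> ! 0 = a + n * b - j" for \<pi> :: "nat list"
  proof -
    have "int (a + n * b - j) = int a + (int m - 1) * int b - int j"
      using jn n by (simp add: of_nat_diff)
    then show ?thesis by (metis of_nat_eq_iff)
  qed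
  let ?P = "\<lambda>a s. real (card (parking_functions a b s))"
  have "measure_pmf.prob (pmf_of_set (parking_functions a b m))
           {\<pi>. int (\<pi> ! 0) = int a + (int m - 1) * int b - int j} =
        real (card {\<pi> \<in> parking_functions a b (Suc n). \<pi> ! 0 = a + n * b - j}) / ?P a m"
    unfolding ev using a1
    by (subst measure_pmf_of_set) (auto simp: finite_parking_functions parking_functions_nonempty n Int_def)
  also have "real (card {\<pi> \<in> parking_functions a b (Suc n). \<pi> ! 0 = a + n * b - j}) =
      (\<Sum>s=n - j div b..n. real (n choose s) * ?P a s * ?P b (n - s))"
    unfolding card_parking_with_first_entry[OF a1 assms(1) jn] by simp
  also have "\<dots> = (\<Sum>i\<le>j div b. real (n choose (n - i)) * ?P a (n - i) * ?P b i)"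
    by (rule sum.reindex_bij_witness[of _ "\<lambda>i. n - i" "\<lambda>s. n - s"]) (use m n in auto)
  also have "\<dots> / ?P a m = (\<Sum>i\<le>j div b. first_entry_term c b i m)"
    unfolding sum_divide_distrib
  proof (intro sum.cong refl)
    fix i assume "i \<in> {..j div b}"
    then have i: "i \<le> n" using m n by simp
    have w: "real a + real (n - i) * real b = Y - real (Suc i) * real b"
      using i n unfolding Y[symmetric] by (simp add: algebra_simps of_nat_diff)
    have b: "real b + real i * real b = real b * real (Suc i)" by (simp add: algebra_simps)
    have "?P a (n - i) / ?P a m = (Y - real (Suc i) * real b) ^ (n - i) / (Y - real (Suc i) * real b) * (Y / Y ^ m)"
      unfolding card_parking_functions[OF a1] w Y using a1 by simp
    moreover have "?P b i = real b ^ i * real (Suc i) ^ i / real (Suc i)"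
      unfolding card_parking_functions[OF assms(1)] b using assms(1)
      by (simp add: power_mult_distrib del: of_nat_Suc)
    moreover have "(n choose (n - i)) = (n choose i)" using i by (rule binomial_symmetric[symmetric])
    moreover have "m - 1 = n" using n by simp
    moreover have "real (n choose (n - i)) * ?P a (n - i) * ?P b i / ?P a m =
        real (n choose (n - i)) * (?P a (n - i) / ?P a m) * ?P b i" by simp
    ultimately show "real (n choose (n - i)) * ?P a (n - i) * ?P b i / ?P a m = first_entry_term c b i m"
      unfolding first_entry_term_def Let_def Y_def[symmetric] by (simp only: mult_ac)
  qed
  finally show ?thesis .
qed

text \<open>
  With \<open>n = m - 1 - i\<close> the term is a product of factors with separate limits. The exponential
  in the Borel mass comes from the \<open>n\<close>-th power of \<open>w / Y = 1 - q / Y\<close> with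
  \<open>q = (i + 1) * b\<close>, where \<open>Y\<close> grows like \<open>(b + c) * n\<close>.
\<close>

lemma first_entry_term_limit:
  fixes b i :: nat and c :: real
  assumes "1 \<le> b" "0 \<le> c"
  shows "(\<lambda>m. real m * first_entry_term c b i m) \<longlonglongrightarrow> borel_mass (real b / (real b + c)) (Suc i) / (real b + c)"
proof -
  define d where "d = real b + c"
  define q where "q = real (Suc i) * real b"
  define Y where "Y n = d * real (n + Suc i) + real b" for n
  define K where "K = real b ^ i * real (Suc i) ^ i / real (Suc i)"
  have pos: "d > 0" "real b > 0" using assms by (auto simp: d_def)
  have w: "Y n - q = d * real n + (c * real (Suc i) + real b)" for n
    unfolding Y_def q_def d_def by (simp add: algebra_simps)
  have wpos: "Y n - q > 0" for n unfolding w using pos assms(2) by (simp add: add_nonneg_pos)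
  have Ypos: "Y n > 0" for n using wpos[of n] pos(2) by (simp add: q_def add_pos_nonneg)
      (smt (verit) mult_nonneg_nonneg of_nat_0_le_iff)
  have eq: "real (n + Suc i) * first_entry_term c b i (n + Suc i) =
     (real (i + n choose n) / real (n ^ i)) * (real n / Y n) ^ i * (real (n + Suc i) / (Y n - q)) * (1 - q / Y n) ^ n * K"
    if "n > 0" for n
  proof -
    have "first_entry_term c b i (n + Suc i) = real (n + i choose i) * ((Y n - q) ^ n / (Y n - q)) * K * (Y n / Y n ^ (n + Suc i))"
      unfolding first_entry_term_def Let_def Y_def q_def K_def d_def by simp
    moreover have "(1 - q / Y n) ^ n = (Y n - q) ^ n / Y n ^ n"
      using Ypos[of n] by (simp add: power_divide[symmetric] diff_divide_distrib)
    moreover have "n + i choose i = (i + n choose n)" by (metis add.commute binomial_symmetric diff_add_inverse2 le_add2)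
    ultimately show ?thesis
      using Ypos[of n] wpos[of n] that by (simp add: power_add power_divide field_simps del: of_nat_Suc of_nat_add)
  qed
  have l1: "(\<lambda>n. real n / Y n) \<longlonglongrightarrow> 1 / d"
    unfolding Y_def of_nat_add using pos by real_asymp (simp add: field_simps)
  have l2: "(\<lambda>n. real (n + Suc i) / (Y n - q)) \<longlonglongrightarrow> 1 / d"
    unfolding w of_nat_add using pos by real_asymp (simp add: field_simps)
  have l3: "(\<lambda>n. (1 - q / Y n) ^ n) \<longlonglongrightarrow> exp (- q / d)"
  proof -
    have "q > 0" using pos by (simp add: q_def)
    then show ?thesis unfolding Y_def of_nat_add using pos by real_asymp (simp add: field_simps)
  qed
  have "(\<lambda>n. (real (i + n choose n) / real (n ^ i)) * (real n / Y n) ^ i * (real (n + Suc i) / (Y n - q)) *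
        (1 - q / Y n) ^ n * K)
      \<longlonglongrightarrow> 1 / fact i * (1 / d) ^ i * (1 / d) * exp (- q / d) * K"
    by (intro tendsto_mult tendsto_power tendsto_const fact_binomial_limit l1 l2 l3)
  also have "1 / fact i * (1 / d) ^ i * (1 / d) * exp (- q / d) * K = borel_mass (real b / d) (Suc i) / d"
    by (simp add: borel_mass_def K_def q_def power_divide power_mult_distrib mult_ac del: of_nat_Suc)
  finally have "(\<lambda>n. real (n + Suc i) * first_entry_term c b i (n + Suc i)) \<longlonglongrightarrow> borel_mass (real b / d) (Suc i) / d"
    by (rule Lim_transform_eventually) (rule eventually_mono[OF eventually_gt_at_top[of 0] eq[symmetric]])
  then show ?thesis unfolding d_def by (rule LIMSEQ_offset)
qed

theorem corollary3p10:
  fixes j b :: nat and c :: real and a :: "nat \<Rightarrow> nat"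
  assumes "1 \<le> b" and "0 \<le> c"
    and "\<And>m. c * real m \<in> \<int> \<Longrightarrow> real (a m) = c * real m + real b"
  shows "(\<lambda>m. measure_pmf.prob (pmf_of_set (parking_functions (a m) b m))
              {\<pi>. int (\<pi> ! 0) = int (a m) + (int m - 1) * int b - int j})
         \<sim>[inf sequentially (principal {m. c * real m \<in> \<int>})]
         (\<lambda>m. (1 - borel_tail (real b / (real b + c)) (j div b + 2)) / ((real b + c) * real m))"
proof -
  define d where "d = real b + c"
  define \<mu> where "\<mu> = real b / d"
  define L where "L = (\<Sum>i\<le>j div b. borel_mass \<mu> (Suc i))"
  define F where "F = inf sequentially (principal {m. c * real m \<in> \<int>})"
  let ?p = "\<lambda>m. measure_pmf.prob (pmf_of_set (parking_functions (a m) b m))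
              {\<pi>. int (\<pi> ! 0) = int (a m) + (int m - 1) * int b - int j}"
  have d: "d > 0" using assms by (simp add: d_def)
  have \<mu>: "0 < \<mu>" "\<mu> \<le> 1" using assms d by (auto simp: \<mu>_def d_def)
  \<comment> \<open>The Borel masses start at \<open>1\<close>, so there are \<open>j div b + 1\<close> of them
    below \<open>j div b + 2\<close>.\<close>
  have tail: "1 - borel_tail \<mu> (j div b + 2) = L"
    unfolding borel_tail_eq[OF \<mu>] L_def
    by (simp add: sum.lessThan_Suc_shift lessThan_Suc_atMost[symmetric] borel_mass_def del: sum.lessThan_Suc)
  have "L > 0" unfolding L_def using \<mu> by (intro sum_pos) (auto simp: borel_mass_def)
  have "(\<lambda>m. \<Sum>i\<le>j div b. real m * first_entry_term c b i m) \<longlonglongrightarrow> (\<Sum>i\<le>j div b. borel_mass \<mu> (Suc i) / d)"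
    unfolding \<mu>_def d_def by (intro tendsto_sum first_entry_term_limit assms)
  \<comment> \<open>The limit along all \<open>m\<close> restricts to the admissible \<open>m\<close>;
    only for these are the probabilities known to be the sums of the terms.\<close>
  then have "((\<lambda>m. (\<Sum>i\<le>j div b. real m * first_entry_term c b i m) / (L / d)) \<longlongrightarrow> (L / d) / (L / d)) F"
    unfolding L_def sum_divide_distrib[symmetric] F_def
    using \<open>L > 0\<close> d by (intro tendsto_divide tendsto_const filterlim_mono[OF _ order_refl inf_le1]) (auto simp: L_def)
  moreover have "\<forall>\<^sub>F m in F. (\<Sum>i\<le>j div b. real m * first_entry_term c b i m) / (L / d) = ?p m / (L / (d * real m))"
    unfolding F_def eventually_inf_principal
    using eventually_gt_at_top[of "j div b"] eventually_gt_at_top[of j]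
  proof eventually_elim
    case (elim m)
    then show ?case
      using prob_first_entry[of b c "a m" m j] assms by (simp add: mult.commute flip: sum_distrib_left)
  qed
  ultimately have "((\<lambda>m. ?p m / (L / (d * real m))) \<longlongrightarrow> 1) F"
    using \<open>L > 0\<close> d by (auto elim!: Lim_transform_eventually)
  then show ?thesis
    unfolding F_def[symmetric] tail[unfolded \<mu>_def d_def] d_def by (rule asymp_equivI')
qed
end
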